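(* The closed form formula of the $k$-Mersenne octonions $M\mathbb{O}_{k,n}$ is $$M\mathbb{O}_{k,n}=\frac{\alpha\lambda_1^{n}-\beta\lambda_2^{n}}{\sqrt{9k^2-8}},$$ where $\alpha=\sum_{r=0}^{7}\lambda_1^{r}e_r$ and $\beta=\sum_{r=0}^{7}\lambda_2^{r}e_r$.
   Context: $\mathbb{O}$ denotes the octonions, the $8$-dimensional real algebra with basis $e_0=1,e_1,\dots,e_7$ (only its vector space structure is needed here). For a parameter $k$, the $k$-Mersenne numbers are defined by $M_{k,0}=0$, $M_{k,1}=1$, $M_{k,n+1}=3kM_{k,n}-2M_{k,n-1}$ for $n\ge1$. The $n$-th $k$-Mersenne octonion is $M\mathbb{O}_{k,n}=\sum_{r=0}^{7}M_{k,n+r}e_r$ for $n\ge 0$. The numbers $\lambda_1=\frac{3k+\sqrt{9k^2-8}}{2}$ and $\lambda_2=\frac{3k-\sqrt{9k^2-8}}{2}$ are the roots of $\lambda^2-3k\lambda+2=0$. *)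

theory Defs
  imports "HOL-Analysis.Analysis"
begin

fun mersenne :: "real \<Rightarrow> nat \<Rightarrow> real" where
  "mersenne k 0 = 0"
| "mersenne k (Suc 0) = 1"
| "mersenne k (Suc (Suc n)) = 3 * k * mersenne k (Suc n) - 2 * mersenne k n"

text \<open>Only the vector space structure of the octonions is used, so they are represented by
  their coordinates in the basis \<open>e\<^sub>0, \<dots>, e\<^sub>7\<close>. Pitfall: the library's componentwise
  multiplication and unit on this vector type are not those of the octonions; the octonion
  unit is \<open>e\<^sub>0\<close>, i.e. \<open>oct_basis 0\<close>.\<close>

type_synonym octonion = "real ^ 8"

text \<open>When \<open>9 k\<^sup>2 < 8\<close> the roots \<open>\<lambda>\<^sub>1, \<lambda>\<^sub>2\<close> are not real, and the
  linear combinations of the \<open>e\<^sub>r\<close> live in the complexification of the octonions.\<close>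

type_synonym complex_octonion = "complex ^ 8"

definition complexify :: "octonion \<Rightarrow> complex_octonion" where
  "complexify x = (\<chi> i. complex_of_real (x $ i))"

text \<open>The index type \<open>8\<close> consists of the residues mod 8, so \<open>of_nat r\<close> for
  \<open>r = 0, \<dots>, 7\<close> enumerates it.\<close>

definition oct_basis :: "nat \<Rightarrow> 'a::field ^ 8" where
  "oct_basis r = axis (of_nat r) 1"

definition mersenne_octonion :: "real \<Rightarrow> nat \<Rightarrow> octonion" where
  "mersenne_octonion k n = (\<Sum>r=0..7. mersenne k (n + r) *s oct_basis r)"

definition lambda1 :: "real \<Rightarrow> real" where
  "lambda1 k = (3 * k + sqrt (9 * k\<^sup>2 - 8)) / 2"

definition lambda2 :: "real \<Rightarrow> real" where
  "lambda2 k = (3 * k - sqrt (9 * k\<^sup>2 - 8)) / 2"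

definition clambda1 :: "real \<Rightarrow> complex" where
  "clambda1 k = (3 * of_real k + csqrt (of_real (9 * k\<^sup>2 - 8))) / 2"

definition clambda2 :: "real \<Rightarrow> complex" where
  "clambda2 k = (3 * of_real k - csqrt (of_real (9 * k\<^sup>2 - 8))) / 2"

text \<open>The common shape of \<open>\<alpha>\<close> (at \<open>\<lambda>\<^sub>1\<close>) and \<open>\<beta>\<close> (at \<open>\<lambda>\<^sub>2\<close>).\<close>

definition power_octonion :: "'a::field \<Rightarrow> 'a ^ 8" where
  "power_octonion l = (\<Sum>r=0..7. l ^ r *s oct_basis r)"

end

theory Submission imports Defs begin

text \<open>
  The Mersenne recurrence has characteristic polynomial \<open>\<lambda>\<^sup>2 - 3 k \<lambda> + 2\<close>. If \<open>a\<close> and \<open>b\<close> are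
  its roots, the sequence \<open>a ^ n - b ^ n\<close> satisfies the same recurrence with initial values
  \<open>0\<close> and \<open>a - b\<close>, so it equals \<open>(a - b) * mersenne k n\<close>; when the roots are distinct one may
  divide by \<open>a - b\<close>, which is a square root of the discriminant \<open>9 k\<^sup>2 - 8\<close>. Applied to the
  index \<open>n + r\<close> in each coordinate \<open>r\<close>, this scalar formula gives the octonion formula, since
  \<open>a ^ (n + r) = a ^ n * a ^ r\<close> lets \<open>a ^ n\<close> be pulled out of the sum over \<open>r\<close>.

  Only the sum and the product of the roots enter, so the argument is carried out over an
  arbitrary field extension of the reals (lemmas \<open>binet_scalar\<close> and \<open>binet_octonion\<close>) and then
  instantiated with the real roots, when the discriminant is positive, and with the complex
  ones, distinct whenever the discriminant is nonzero.
\<close>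

lemma binet_scalar:
  fixes a b :: "'a::real_field"
  assumes sum_roots: "a + b = 3 * of_real k" and prod_roots: "a * b = 2"
  shows "(a - b) * of_real (mersenne k n) = a ^ n - b ^ n"
proof (induction n rule: induct_nat_012)
  case (ge2 n)
  have "(a - b) * of_real (mersenne k (Suc (Suc n)))
      = (3 * of_real k) * ((a - b) * of_real (mersenne k (Suc n)))
        - 2 * ((a - b) * of_real (mersenne k n))"
    by (simp add: algebra_simps)
  also have "\<dots> = (a + b) * (a ^ Suc n - b ^ Suc n) - a * b * (a ^ n - b ^ n)"
    by (simp only: ge2 sum_roots prod_roots)
  also have "\<dots> = a ^ Suc (Suc n) - b ^ Suc (Suc n)"
    by (simp add: algebra_simps)
  finally show ?case .
qed simp_all

text \<open>The coefficients of the octonion are embedded in the field of the roots, so that the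
  real formula (embedding the identity) and its complexification are both instances.\<close>

lemma binet_octonion:
  fixes a b :: "'a::real_field"
  assumes sum_roots: "a + b = 3 * of_real k" and prod_roots: "a * b = 2"
    and distinct_roots: "a \<noteq> b"
  shows "(\<chi> i. of_real (mersenne_octonion k n $ i))
       = inverse (a - b) *s (a ^ n *s power_octonion a - b ^ n *s power_octonion b)"
proof -
  have binet: "of_real (mersenne k m) = inverse (a - b) * (a ^ m - b ^ m)" for m
    using binet_scalar[OF sum_roots prod_roots, of m] distinct_roots
    by (simp add: field_simps)
  have basis: "of_real (oct_basis r $ i) = (oct_basis r $ i :: 'a)" for r and i :: 8
    by (simp add: oct_basis_def axis_def)
  have "of_real (mersenne_octonion k n $ i)
      = inverse (a - b) * (a ^ n * power_octonion a $ i - b ^ n * power_octonion b $ i)" for i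
  proof -
    have "of_real (mersenne_octonion k n $ i)
        = (\<Sum>r=0..7. inverse (a - b) * (a ^ (n + r) - b ^ (n + r)) * oct_basis r $ i)"
      by (simp only: mersenne_octonion_def sum_component vector_smult_component
          of_real_sum of_real_mult basis binet)
    also have "\<dots> = (\<Sum>r=0..7. inverse (a - b) *
        (a ^ n * (a ^ r * oct_basis r $ i) - b ^ n * (b ^ r * oct_basis r $ i)))"
      by (simp add: power_add algebra_simps)
    also have "\<dots> = inverse (a - b) *
        (a ^ n * power_octonion a $ i - b ^ n * power_octonion b $ i)"
      by (simp only: power_octonion_def sum_component vector_smult_component
          sum_distrib_left[symmetric] sum_subtractf)
    finally show ?thesis .
  qed
  then show ?thesis
    by (simp add: vec_eq_iff algebra_simps)
qed

text \<open>Vieta's formulas for the two closed forms of the roots, with \<open>s\<close> a square root of the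
  discriminant.\<close>

lemma vieta:
  fixes c s :: "'a::field_char_0"
  assumes "s\<^sup>2 = 9 * c\<^sup>2 - 8"
  shows "(3 * c + s) / 2 + (3 * c - s) / 2 = 3 * c"
    and "(3 * c + s) / 2 * ((3 * c - s) / 2) = 2"
    and "(3 * c + s) / 2 - (3 * c - s) / 2 = s"
proof -
  show "(3 * c + s) / 2 + (3 * c - s) / 2 = 3 * c"
    and "(3 * c + s) / 2 - (3 * c - s) / 2 = s"
    by (simp_all add: field_simps)
  have "(3 * c + s) / 2 * ((3 * c - s) / 2) = (9 * c\<^sup>2 - s\<^sup>2) / 4"
    by (simp add: field_simps power2_eq_square)
  then show "(3 * c + s) / 2 * ((3 * c - s) / 2) = 2"
    using assms by simp
qed

theorem theorem2p2:
  fixes k :: real and n :: nat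
  assumes "9 * k\<^sup>2 \<noteq> 8"
  shows "(9 * k\<^sup>2 > 8 \<longrightarrow>
            (let \<alpha> = power_octonion (lambda1 k); \<beta> = power_octonion (lambda2 k) in
             mersenne_octonion k n =
               inverse (sqrt (9 * k\<^sup>2 - 8)) *s (lambda1 k ^ n *s \<alpha> - lambda2 k ^ n *s \<beta>))) \<and>
         (let \<alpha> = power_octonion (clambda1 k); \<beta> = power_octonion (clambda2 k) in
          complexify (mersenne_octonion k n) =
            inverse (csqrt (of_real (9 * k\<^sup>2 - 8))) *s
              (clambda1 k ^ n *s \<alpha> - clambda2 k ^ n *s \<beta>))"
proof -
  have real_case: "mersenne_octonion k n =
      inverse (sqrt (9 * k\<^sup>2 - 8)) *s
        (lambda1 k ^ n *s power_octonion (lambda1 k) - lambda2 k ^ n *s power_octonion (lambda2 k))"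
    if "9 * k\<^sup>2 > 8"
  proof -
    have sq: "(sqrt (9 * k\<^sup>2 - 8))\<^sup>2 = 9 * k\<^sup>2 - 8"
      using that by simp
    note roots = vieta[OF sq, folded lambda1_def lambda2_def]
    have "lambda1 k \<noteq> lambda2 k"
      using roots(3) that by auto
    from binet_octonion[OF _ roots(2) this, of k n] roots(1)
    show ?thesis
      by (simp add: roots(3))
  qed
  have complex_case: "complexify (mersenne_octonion k n) =
      inverse (csqrt (of_real (9 * k\<^sup>2 - 8))) *s
        (clambda1 k ^ n *s power_octonion (clambda1 k) - clambda2 k ^ n *s power_octonion (clambda2 k))"
  proof -
    have sq: "(csqrt (of_real (9 * k\<^sup>2 - 8)))\<^sup>2 = 9 * (complex_of_real k)\<^sup>2 - 8"
      by simp
    note roots = vieta[OF sq, folded clambda1_def clambda2_def]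
    have "complex_of_real (9 * k\<^sup>2 - 8) \<noteq> 0"
      using assms by (simp only: of_real_eq_0_iff)
    then have "clambda1 k \<noteq> clambda2 k"
      using roots(3) by (metis csqrt_eq_0 right_minus_eq)
    from binet_octonion[OF roots(1,2) this, of n]
    show ?thesis
      by (simp only: roots(3) complexify_def)
  qed
  show ?thesis
    unfolding Let_def using real_case complex_case by blast
qed

end
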